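(* The hydrostatic reconstruction scheme with the numerical flux $\mathbf f^{ES}_\epsilon=\mathbf f^{EC}_\epsilon-\tfrac12|\lambda_{\max}|[\![\mathbf u_\epsilon]\!]$ is positivity preserving under the CFL condition $$\Delta t\le\frac{\Delta x}{2|\lambda_{\max}|}$$ (required at every interface) when a first-order forward Euler method is used for time integration; that is, if $h_{m,i}^n\ge0$ for all layers $m$ and cells $i$ at time level $n$, then $h_{m,i}^{n+1}\ge0$ for all $m,i$.
   Context: Constants: $M\ge1$ layers ($M=1$: shallow water equations; general $M$: multilayer shallow water equations), $g>0$, densities $0<\rho_1<\dots<\rho_M$ (layers counted top to bottom), $\sigma_{km}=\rho_k/\rho_m$. Equations, $m=1,\dots,M$: $\partial_t h_m+\partial_x(h_mv_m)=0$, $\partial_t(h_mv_m)+\partial_x(h_mv_m^2)=-gh_m\partial_x\big(b+\sum_{k\ge m}h_k+\sum_{k<m}\sigma_{km}h_k\big)$. Layer components: $\mathbf u_m=(h_m,h_mv_m)^T$, $\boldsymbol\phi_m=g(0,h_m)^T$, $\mathbf r_m=\big(0,\,b+\sum_{k\ge m}h_k+\sum_{k<m}\sigma_{km}h_k\big)^T$; unindexed symbols are stacked vectors, $\circ$ the Hadamard product. Data: uniform one-dimensional cells (infinite or periodic grid) of size $\Delta x$ with constant values $b_i\in\mathbb R$, $h_{m,i}\ge0$, $v_{m,i}\in\mathbb R$; $H_m=b+\sum_{k\ge m}h_k$. At interface $i+\frac12$, $-$ denotes values of cell $i$, $+$ of cell $i+1$; $\{\!\{a\}\!\}=\frac12(a^++a^-)$,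 $[\![a]\!]=a^+-a^-$. Hydrostatic reconstruction at each interface: $b_\epsilon^\pm=\min(H_1^\pm,\max(b^-,b^+))$, $H_{m,\epsilon}^\pm=\max(H_m^\pm,b_\epsilon^\pm)$, $h_{M,\epsilon}^\pm=H_{M,\epsilon}^\pm-b_\epsilon^\pm$, $h_{m,\epsilon}^\pm=H_{m,\epsilon}^\pm-H_{m+1,\epsilon}^\pm$ for $m<M$, $\mathbf u_{m,\epsilon}^\pm=(h_{m,\epsilon}^\pm,h_{m,\epsilon}^\pm v_m^\pm)^T$; $\boldsymbol\phi_\epsilon^\pm,\mathbf r_\epsilon^\pm$ are evaluated with $h_{m,\epsilon}^\pm,b_\epsilon^\pm$. Scheme: $\Delta x\frac{d}{dt}\mathbf u_i=-(\mathbf f^{ES}_{\epsilon,i+1/2}-\mathbf f^{ES}_{\epsilon,i-1/2})-\tfrac12\boldsymbol\phi^-_{\epsilon,i+1/2}\circ[\![\mathbf r_\epsilon]\!]_{i+1/2}-\tfrac12\boldsymbol\phi^+_{\epsilon,i-1/2}\circ[\![\mathbf r_\epsilon]\!]_{i-1/2}$, discretized in time by forward Euler with step $\Delta t$. Fluxes: $\mathbf f^{EC}_{m,\epsilon}=\big(\{\!\{h_{m,\epsilon}v_m\}\!\},\ \{\!\{h_{m,\epsilon}v_m\}\!\}\{\!\{v_m\}\!\}\big)^T$, and at each interface $\lambda_{\max}=\max\Big(\Big|\tfrac{\sum_mh_m^+v_m^+}{\sum_mh_m^+}\Big|,\Big|\tfrac{\sum_mh_m^-v_m^-}{\sum_mh_m^-}\Big|,\max_m|v_m^+|,\max_m|v_m^-|\Big)+\max\Big(\sqrt{g\sum_mh_m^+},\sqrt{g\sum_mh_m^-}\Big)$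 (a quotient with zero denominator is omitted). *)

theory Defs
  imports "HOL-Analysis.Analysis"
begin

text \<open>
  A cell carries the bottom topography, the layer heights and the layer velocities. The layers are
  numbered \<open>1, \<dots>, M\<close> from top to bottom; values at other layer indices are irrelevant. The velocities
  are data of their own, so that they also make sense in a dry layer.

  The cells are numbered by the integers. Data on a periodic grid of \<open>N\<close> cells are \<open>N\<close>-periodic data
  on the integers.
\<close>

record cell =
  bottom :: real
  height :: "nat \<Rightarrow> real"
  velocity :: "nat \<Rightarrow> real"

definition avg :: "real \<Rightarrow> real \<Rightarrow> real" where
  "avg am ap = (ap + am) / 2"

definition jump :: "real^2 \<Rightarrow> real^2 \<Rightarrow> real^2" where
  "jump am ap = ap - am"

definition layer_u :: "cell \<Rightarrow> nat \<Rightarrow> real^2" where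
  "layer_u c m = vector [height c m, height c m * velocity c m]"

definition layer_phi :: "real \<Rightarrow> cell \<Rightarrow> nat \<Rightarrow> real^2" where
  "layer_phi g c m = g *\<^sub>R vector [0, height c m]"

definition layer_r :: "nat \<Rightarrow> (nat \<Rightarrow> real) \<Rightarrow> cell \<Rightarrow> nat \<Rightarrow> real^2" where
  "layer_r M \<rho> c m =
     vector [0, bottom c + (\<Sum>k=m..M. height c k) + (\<Sum>k=1..<m. \<rho> k / \<rho> m * height c k)]"

definition surface :: "nat \<Rightarrow> cell \<Rightarrow> nat \<Rightarrow> real" where
  "surface M c m = bottom c + (\<Sum>k=m..M. height c k)"

text \<open>
  Hydrostatic reconstruction at the interface between the left cell \<open>L\<close> and the right cell \<open>R\<close>.
  The argument \<open>c\<close> is the side being reconstructed: \<open>c = L\<close> gives the values with superscript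
  minus, \<open>c = R\<close> those with superscript plus.
\<close>

definition recon_bottom :: "nat \<Rightarrow> cell \<Rightarrow> cell \<Rightarrow> cell \<Rightarrow> real" where
  "recon_bottom M L R c = min (surface M c 1) (max (bottom L) (bottom R))"

definition recon_surface :: "nat \<Rightarrow> cell \<Rightarrow> cell \<Rightarrow> cell \<Rightarrow> nat \<Rightarrow> real" where
  "recon_surface M L R c m = max (surface M c m) (recon_bottom M L R c)"

definition recon_height :: "nat \<Rightarrow> cell \<Rightarrow> cell \<Rightarrow> cell \<Rightarrow> nat \<Rightarrow> real" where
  "recon_height M L R c m =
     (if m = M then recon_surface M L R c M - recon_bottom M L R c
      else recon_surface M L R c m - recon_surface M L R c (m + 1))"

definition recon :: "nat \<Rightarrow> cell \<Rightarrow> cell \<Rightarrow> cell \<Rightarrow> cell" where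
  "recon M L R c =
     \<lparr>bottom = recon_bottom M L R c, height = recon_height M L R c, velocity = velocity c\<rparr>"

text \<open>The maximal speed is computed from the heights before reconstruction.\<close>

definition total_height :: "nat \<Rightarrow> cell \<Rightarrow> real" where
  "total_height M c = (\<Sum>m=1..M. height c m)"

definition lambda_max :: "real \<Rightarrow> nat \<Rightarrow> cell \<Rightarrow> cell \<Rightarrow> real" where
  "lambda_max g M L R =
     Max ({\<bar>(\<Sum>m=1..M. height c m * velocity c m) / total_height M c\<bar> | c.
             c \<in> {L, R} \<and> total_height M c \<noteq> 0}
          \<union> {\<bar>velocity c m\<bar> | c m. c \<in> {L, R} \<and> m \<in> {1..M}})
     + max (sqrt (g * total_height M R)) (sqrt (g * total_height M L))"

definition flux_EC :: "cell \<Rightarrow> cell \<Rightarrow> nat \<Rightarrow> real^2" where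
  "flux_EC L R m =
     vector [avg (height L m * velocity L m) (height R m * velocity R m),
             avg (height L m * velocity L m) (height R m * velocity R m)
               * avg (velocity L m) (velocity R m)]"

definition flux_ES :: "real \<Rightarrow> nat \<Rightarrow> cell \<Rightarrow> cell \<Rightarrow> nat \<Rightarrow> real^2" where
  "flux_ES g M L R m =
     flux_EC (recon M L R L) (recon M L R R) m
     - (\<bar>lambda_max g M L R\<bar> / 2) *\<^sub>R
         jump (layer_u (recon M L R L) m) (layer_u (recon M L R R) m)"

definition jump_r_recon :: "nat \<Rightarrow> (nat \<Rightarrow> real) \<Rightarrow> cell \<Rightarrow> cell \<Rightarrow> nat \<Rightarrow> real^2" where
  "jump_r_recon M \<rho> L R m =
     jump (layer_r M \<rho> (recon M L R L) m) (layer_r M \<rho> (recon M L R R) m)"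

text \<open>
  The right-hand side of the semi-discrete scheme in cell \<open>i\<close>, layer \<open>m\<close>. Multiplication on
  \<^typ>\<open>real^2\<close> is componentwise, that is, the Hadamard product.
\<close>

definition scheme_rhs ::
    "real \<Rightarrow> nat \<Rightarrow> (nat \<Rightarrow> real) \<Rightarrow> (int \<Rightarrow> cell) \<Rightarrow> int \<Rightarrow> nat \<Rightarrow> real^2" where
  "scheme_rhs g M \<rho> q i m =
     - (flux_ES g M (q i) (q (i + 1)) m - flux_ES g M (q (i - 1)) (q i) m)
     - (1/2) *\<^sub>R (layer_phi g (recon M (q i) (q (i + 1)) (q i)) m
                    * jump_r_recon M \<rho> (q i) (q (i + 1)) m)
     - (1/2) *\<^sub>R (layer_phi g (recon M (q (i - 1)) (q i) (q i)) m
                    * jump_r_recon M \<rho> (q (i - 1)) (q i) m)"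

definition euler_step ::
    "real \<Rightarrow> nat \<Rightarrow> (nat \<Rightarrow> real) \<Rightarrow> real \<Rightarrow> real \<Rightarrow> (int \<Rightarrow> cell) \<Rightarrow> int \<Rightarrow> nat \<Rightarrow> real^2" where
  "euler_step g M \<rho> \<Delta>x \<Delta>t q i m = layer_u (q i) m + (\<Delta>t / \<Delta>x) *\<^sub>R scheme_rhs g M \<rho> q i m"

text \<open>
  The step size restriction at every interface. Where \<open>lambda_max\<close> vanishes (two dry cells at rest)
  the bound \<open>\<Delta>x / (2 * \<bar>lambda_max\<bar>)\<close> is infinite and there is no restriction, whereas
  the HOL convention \<open>x / 0 = 0\<close> would exclude every positive time step.
\<close>

definition CFL :: "real \<Rightarrow> nat \<Rightarrow> real \<Rightarrow> real \<Rightarrow> (int \<Rightarrow> cell) \<Rightarrow> bool" where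
  "CFL g M \<Delta>x \<Delta>t q \<longleftrightarrow>
     (\<forall>i. lambda_max g M (q i) (q (i + 1)) \<noteq> 0 \<longrightarrow>
          \<Delta>t \<le> \<Delta>x / (2 * \<bar>lambda_max g M (q i) (q (i + 1))\<bar>))"

end

theory Submission
  imports Defs
begin

text \<open>
  In the first component the source terms vanish, because the first component of \<open>layer_phi\<close> is
  zero. The mass flux at an interface splits as
  \<open>h\<^sub>L (v\<^sub>L + \<Lambda>) / 2 + h\<^sub>R (v\<^sub>R - \<Lambda>) / 2\<close> in terms of the reconstructed heights, where
  \<open>\<Lambda> = \<bar>lambda_max\<bar>\<close>. Since \<open>\<Lambda>\<close> dominates
  both velocities (\<open>velocity_le_lambda_max\<close>), the first summand lies between \<open>0\<close> and \<open>\<Lambda> h\<^sub>L\<close>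
  and the second between \<open>- \<Lambda> h\<^sub>R\<close> and \<open>0\<close>. Moreover, the reconstructed heights are nonnegative and
  never exceed the original ones (\<open>recon_height_nonneg\<close>, \<open>recon_height_le\<close>). Thus a cell of
  height \<open>h\<close> loses mass through each of its interfaces at a rate of at most \<open>\<Lambda> h\<close>, which by the
  step size restriction amounts to at most \<open>h / 2\<close> per interface during one time step.
\<close>

lemma surface_Suc:
  assumes "m < M"
  shows "surface M c m = height c m + surface M c (m + 1)"
  using assms by (simp add: surface_def sum.atLeast_Suc_atMost)

lemma recon_height_nonneg:
  assumes "\<forall>k\<in>{1..M}. 0 \<le> height c k" "m \<in> {1..M}"
  shows "0 \<le> recon_height M L R c m"
proof (cases "m = M")
  case True
  then show ?thesis by (simp add: recon_height_def recon_surface_def)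
next
  case False
  then have "surface M c (m + 1) \<le> surface M c m"
    using assms surface_Suc[of m M c] by auto
  then show ?thesis using False by (simp add: recon_height_def recon_surface_def max_def)
qed

lemma recon_height_le:
  assumes nonneg: "\<forall>k\<in>{1..M}. 0 \<le> height c k" and m: "m \<in> {1..M}" and c: "c \<in> {L, R}"
  shows "recon_height M L R c m \<le> height c m"
proof (cases "m = M")
  case True
  \<comment> \<open>The bottom layer does not grow because the reconstruction never lowers the bottom.\<close>
  have "0 \<le> (\<Sum>k=1..M. height c k)"
    using nonneg by (intro sum_nonneg) auto
  then have "bottom c \<le> recon_bottom M L R c"
    using c by (auto simp: recon_bottom_def surface_def)
  moreover have "surface M c M = bottom c + height c M" "0 \<le> height c M"
    using nonneg m True by (auto simp: surface_def)
  ultimately show ?thesis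
    using True by (simp add: recon_height_def recon_surface_def)
next
  case False
  then have "surface M c m = height c m + surface M c (m + 1)" "0 \<le> height c m"
    using nonneg m surface_Suc[of m M c] by auto
  then show ?thesis
    using False by (simp add: recon_height_def recon_surface_def max_def)
qed

lemma velocity_le_lambda_max:
  assumes g: "0 \<le> g"
    and nonneg: "\<forall>k\<in>{1..M}. 0 \<le> height R k"
    and m: "m \<in> {1..M}" and c: "c \<in> {L, R}"
  shows "\<bar>velocity c m\<bar> \<le> lambda_max g M L R"
proof -
  let ?mean = "\<lambda>c. \<bar>(\<Sum>m=1..M. height c m * velocity c m) / total_height M c\<bar>"
  let ?A = "{?mean c | c. c \<in> {L, R} \<and> total_height M c \<noteq> 0}"
  let ?B = "{\<bar>velocity c m\<bar> | c m. c \<in> {L, R} \<and> m \<in> {1..M}}"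
  have "finite ?A"
    by (rule finite_subset[of _ "?mean ` {L, R}"]) auto
  moreover have "finite ?B"
    by (rule finite_subset[of _ "(\<lambda>(c, m). \<bar>velocity c m\<bar>) ` ({L, R} \<times> {1..M})"]) auto
  moreover have "\<bar>velocity c m\<bar> \<in> ?A \<union> ?B"
    using m c by blast
  ultimately have "\<bar>velocity c m\<bar> \<le> Max (?A \<union> ?B)"
    by (intro Max_ge) auto
  moreover have "0 \<le> sqrt (g * total_height M R)"
    using g nonneg by (auto simp: total_height_def intro!: mult_nonneg_nonneg sum_nonneg)
  ultimately show ?thesis
    unfolding lambda_max_def by linarith
qed

lemma flux_ES_mass:
  "flux_ES g M L R m $ 1 =
     (recon_height M L R L m * (velocity L m + \<bar>lambda_max g M L R\<bar>)
      + recon_height M L R R m * (velocity R m - \<bar>lambda_max g M L R\<bar>)) / 2"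
  by (simp add: flux_ES_def flux_EC_def recon_def jump_def layer_u_def avg_def field_simps)

lemma flux_ES_mass_bounds:
  assumes g: "0 \<le> g"
    and L: "\<forall>k\<in>{1..M}. 0 \<le> height L k" and R: "\<forall>k\<in>{1..M}. 0 \<le> height R k"
    and m: "m \<in> {1..M}"
  shows "flux_ES g M L R m $ 1 \<le> \<bar>lambda_max g M L R\<bar> * height L m"
    and "- (\<bar>lambda_max g M L R\<bar> * height R m) \<le> flux_ES g M L R m $ 1"
proof -
  let ?\<Lambda> = "\<bar>lambda_max g M L R\<bar>"
  let ?hL = "recon_height M L R L m" and ?hR = "recon_height M L R R m"
  have v: "\<bar>velocity L m\<bar> \<le> ?\<Lambda>" "\<bar>velocity R m\<bar> \<le> ?\<Lambda>"
    using velocity_le_lambda_max[OF g R m, of L L] velocity_le_lambda_max[OF g R m, of R L]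
    by auto
  have h: "0 \<le> ?hL" "0 \<le> ?hR" "?hL \<le> height L m" "?hR \<le> height R m"
    using recon_height_nonneg[OF L m] recon_height_nonneg[OF R m]
      recon_height_le[OF L m] recon_height_le[OF R m] by auto
  have "0 \<le> ?hL * (velocity L m + ?\<Lambda>)" "?hR * (velocity R m - ?\<Lambda>) \<le> 0"
    using h v by (auto intro!: mult_nonneg_nonneg mult_nonneg_nonpos)
  moreover have "?hL * (velocity L m + ?\<Lambda>) \<le> height L m * (2 * ?\<Lambda>)"
    using h v by (intro mult_mono) auto
  moreover have "?hR * (?\<Lambda> - velocity R m) \<le> height R m * (2 * ?\<Lambda>)"
    using h v by (intro mult_mono) auto
  ultimately show "flux_ES g M L R m $ 1 \<le> ?\<Lambda> * height L m"
    and "- (?\<Lambda> * height R m) \<le> flux_ES g M L R m $ 1"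
    unfolding flux_ES_mass by (simp_all add: algebra_simps)
qed

lemma euler_step_mass:
  "euler_step g M \<rho> \<Delta>x \<Delta>t q i m $ 1 =
     height (q i) m
     - \<Delta>t / \<Delta>x * (flux_ES g M (q i) (q (i + 1)) m $ 1 - flux_ES g M (q (i - 1)) (q i) m $ 1)"
  by (simp add: euler_step_def scheme_rhs_def layer_u_def layer_phi_def algebra_simps)

lemma CFL_D:
  assumes "CFL g M \<Delta>x \<Delta>t q" "0 < \<Delta>x"
  shows "\<Delta>t / \<Delta>x * \<bar>lambda_max g M (q i) (q (i + 1))\<bar> \<le> 1 / 2"
proof (cases "lambda_max g M (q i) (q (i + 1)) = 0")
  case False
  then have "\<Delta>t \<le> \<Delta>x / (2 * \<bar>lambda_max g M (q i) (q (i + 1))\<bar>)"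
    using assms(1) by (simp add: CFL_def)
  then show ?thesis
    using False assms(2) by (simp add: field_simps)
qed simp

theorem lemma9:
  fixes g \<Delta>x \<Delta>t :: real and M :: nat and \<rho> :: "nat \<Rightarrow> real" and q :: "int \<Rightarrow> cell"
  assumes "M \<ge> 1"
    and "g > 0"
    and "\<forall>m\<in>{1..M}. 0 < \<rho> m"
    and "strict_mono_on {1..M} \<rho>"
    and "\<Delta>x > 0"
    and "\<Delta>t > 0"
    and "CFL g M \<Delta>x \<Delta>t q"
    and "\<forall>i. \<forall>m\<in>{1..M}. height (q i) m \<ge> 0"
  shows "\<forall>i. \<forall>m\<in>{1..M}. euler_step g M \<rho> \<Delta>x \<Delta>t q i m $ 1 \<ge> 0"
proof (intro allI ballI)
  fix i m
  assume m: "m \<in> {1..M}"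
  define h where "h = height (q i) m"
  define F where "F = (\<lambda>j. flux_ES g M (q j) (q (j + 1)) m $ 1)"
  define \<Lambda> where "\<Lambda> = (\<lambda>j. \<bar>lambda_max g M (q j) (q (j + 1))\<bar>)"
  have h: "0 \<le> h"
    using assms(8) m by (simp add: h_def)
  have "F i \<le> \<Lambda> i * h" "- (\<Lambda> (i - 1) * h) \<le> F (i - 1)"
    using flux_ES_mass_bounds(1)[of g M "q i" "q (i + 1)" m]
      flux_ES_mass_bounds(2)[of g M "q (i - 1)" "q i" m] assms(2,8) m
    by (auto simp: F_def \<Lambda>_def h_def)
  then have "F i - F (i - 1) \<le> (\<Lambda> i + \<Lambda> (i - 1)) * h"
    by (simp add: algebra_simps)
  then have "\<Delta>t / \<Delta>x * (F i - F (i - 1)) \<le> \<Delta>t / \<Delta>x * ((\<Lambda> i + \<Lambda> (i - 1)) * h)"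
    using assms(5,6) by (intro mult_left_mono) auto
  also have "\<dots> = (\<Delta>t / \<Delta>x * \<Lambda> i + \<Delta>t / \<Delta>x * \<Lambda> (i - 1)) * h"
    by (simp only: distrib_left distrib_right mult.assoc)
  also have "\<dots> \<le> 1 * h"
    using CFL_D[OF assms(7,5), of i] CFL_D[OF assms(7,5), of "i - 1"] h
    unfolding \<Lambda>_def by (intro mult_right_mono) linarith+
  finally show "0 \<le> euler_step g M \<rho> \<Delta>x \<Delta>t q i m $ 1"
    by (simp add: euler_step_mass F_def h_def)
qed

end
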